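(* For every $\gamma\in\mathrm{Sp}(n+1,1)$, acting on the standard qc sphere $S^{4n+3}$, and every $\zeta\in S^{4n+3}$, one has $$H_{\gamma(\zeta)}=\gamma_*H_\zeta\quad\text{and}\quad \gamma^*g_S\big|_\zeta=\frac{1}{|[(\zeta,1)\gamma]_{n+2}|^2}\,g_S\big|_\zeta .$$
   Context: $\mathbb{H}$ denotes the quaternions. $S^{4n+3}=\{\zeta\in\mathbb{H}^{n+1}:|\zeta|=1\}$; the horizontal subspace at $\zeta$ is $H_\zeta=\{v\in\mathbb{H}^{n+1}:\sum_{l=1}^{n+1}v_l\bar\zeta_l=0\}$, regarded as a subspace of $T_\zeta S^{4n+3}$; $g_S$ is the restriction to $H$ of $4$ times the Euclidean metric. $\mathrm{Sp}(n+1,1)$ is the group of quaternionic $(n+2)\times(n+2)$ matrices preserving the form $-q_1\bar p_1-\cdots-q_{n+1}\bar p_{n+1}+q_{n+2}\bar p_{n+2}$ on the left quaternionic vector space $\mathbb{H}^{n+2}$, acting on row vectors from the right. For $q\in\mathbb{H}^{n+1}$, $[(q,1)\gamma]_l=\sum_{m=1}^{n+1}q_m\gamma_{ml}+\gamma_{(n+2)l}$ is the $l$-th component of $(q,1)\gamma$, and $\gamma$ acts on $S^{4n+3}$ by $\gamma(q)=\big([(q,1)\gamma]_{n+2}^{-1}[(q,1)\gamma]_1,\dots,[(q,1)\gamma]_{n+2}^{-1}[(q,1)\gamma]_{n+1}\big)$ (where $[(q,1)\gamma]_{n+2}\ne0$). *)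

theory Defs
  imports "HOL-Analysis.Analysis"
begin

section \<open>Quaternions\<close>

datatype quat = Quat (qre: real) (qi: real) (qj: real) (qk: real)

lemma quat_eqI:
  "qre x = qre y \<Longrightarrow> qi x = qi y \<Longrightarrow> qj x = qj y \<Longrightarrow> qk x = qk y \<Longrightarrow> x = y"
  by (cases x; cases y) simp

lemma quat_eq_iff:
  "x = y \<longleftrightarrow> qre x = qre y \<and> qi x = qi y \<and> qj x = qj y \<and> qk x = qk y"
  by (auto intro: quat_eqI)

instantiation quat :: ring_1
begin

definition "0 = Quat 0 0 0 0"

definition "1 = Quat 1 0 0 0"

definition "x + y = Quat (qre x + qre y) (qi x + qi y) (qj x + qj y) (qk x + qk y)"

definition "- x = Quat (- qre x) (- qi x) (- qj x) (- qk x)"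

definition "x - y = Quat (qre x - qre y) (qi x - qi y) (qj x - qj y) (qk x - qk y)"

definition "x * y = Quat
  (qre x * qre y - qi x * qi y - qj x * qj y - qk x * qk y)
  (qre x * qi y + qi x * qre y + qj x * qk y - qk x * qj y)
  (qre x * qj y - qi x * qk y + qj x * qre y + qk x * qi y)
  (qre x * qk y + qi x * qj y - qj x * qi y + qk x * qre y)"

instance
  by standard
    (simp_all add: quat_eq_iff zero_quat_def one_quat_def plus_quat_def uminus_quat_def
      minus_quat_def times_quat_def algebra_simps)

end

lemma quat_sel_zero [simp]: "qre 0 = 0" "qi 0 = 0" "qj 0 = 0" "qk 0 = 0"
  by (simp_all add: zero_quat_def)

lemma quat_sel_one [simp]: "qre 1 = 1" "qi 1 = 0" "qj 1 = 0" "qk 1 = 0"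
  by (simp_all add: one_quat_def)

lemma quat_sel_plus [simp]:
  "qre (x + y) = qre x + qre y" "qi (x + y) = qi x + qi y"
  "qj (x + y) = qj x + qj y" "qk (x + y) = qk x + qk y"
  by (simp_all add: plus_quat_def)

lemma quat_sel_uminus [simp]:
  "qre (- x) = - qre x" "qi (- x) = - qi x" "qj (- x) = - qj x" "qk (- x) = - qk x"
  by (simp_all add: uminus_quat_def)

lemma quat_sel_minus [simp]:
  "qre (x - y) = qre x - qre y" "qi (x - y) = qi x - qi y"
  "qj (x - y) = qj x - qj y" "qk (x - y) = qk x - qk y"
  by (simp_all add: minus_quat_def)

lemma quat_sel_times [simp]:
  "qre (x * y) = qre x * qre y - qi x * qi y - qj x * qj y - qk x * qk y"
  "qi (x * y) = qre x * qi y + qi x * qre y + qj x * qk y - qk x * qj y"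
  "qj (x * y) = qre x * qj y - qi x * qk y + qj x * qre y + qk x * qi y"
  "qk (x * y) = qre x * qk y + qi x * qj y - qj x * qi y + qk x * qre y"
  by (simp_all add: times_quat_def)

definition qcnj :: "quat \<Rightarrow> quat"
  where "qcnj x = Quat (qre x) (- qi x) (- qj x) (- qk x)"

lemma quat_sel_qcnj [simp]:
  "qre (qcnj x) = qre x" "qi (qcnj x) = - qi x" "qj (qcnj x) = - qj x" "qk (qcnj x) = - qk x"
  by (simp_all add: qcnj_def)

instantiation quat :: real_algebra_1
begin

definition "scaleR r x = Quat (r * qre x) (r * qi x) (r * qj x) (r * qk x)"

instance
  by standard (simp_all add: quat_eq_iff scaleR_quat_def algebra_simps)

end

lemma quat_sel_scaleR [simp]:
  "qre (scaleR r x) = r * qre x" "qi (scaleR r x) = r * qi x"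
  "qj (scaleR r x) = r * qj x" "qk (scaleR r x) = r * qk x"
  by (simp_all add: scaleR_quat_def)

instantiation quat :: real_inner
begin

definition "inner x y = qre x * qre y + qi x * qi y + qj x * qj y + qk x * qk y"

definition "norm (x :: quat) = sqrt (inner x x)"

definition "sgn (x :: quat) = x /\<^sub>R norm x"

definition "dist (x :: quat) y = norm (x - y)"

definition
  "(uniformity :: (quat \<times> quat) filter) = (INF e\<in>{0 <..}. principal {(x, y). dist x y < e})"

definition
  "open (U :: quat set) \<longleftrightarrow> (\<forall>x\<in>U. eventually (\<lambda>(x', y). x' = x \<longrightarrow> y \<in> U) uniformity)"

instance
proof
  fix x :: quat
  show "inner x x = 0 \<longleftrightarrow> x = 0"
    by (simp add: inner_quat_def quat_eq_iff add_nonneg_eq_0_iff)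
qed (simp_all add: inner_quat_def norm_quat_def sgn_quat_def dist_quat_def
      uniformity_quat_def open_quat_def algebra_simps)

end

instantiation quat :: real_normed_div_algebra
begin

definition "inverse x = scaleR (1 / (norm x)\<^sup>2) (qcnj x)"

definition "x div (y :: quat) = x * inverse y"

instance
proof
  fix x y :: quat
  have nn: "(norm x)\<^sup>2 = qre x * qre x + qi x * qi x + qj x * qj x + qk x * qk x"
    by (simp add: power2_norm_eq_inner inner_quat_def)
  { assume "x \<noteq> 0"
    then have "(norm x)\<^sup>2 \<noteq> 0"
      by simp
    then show "inverse x * x = 1" "x * inverse x = 1"
      by (simp_all add: inverse_quat_def quat_eq_iff divide_simps)
        (simp_all add: nn algebra_simps) }
  show "x div y = x * inverse y"
    by (rule divide_quat_def)
  show "inverse (0 :: quat) = 0"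
    by (simp add: inverse_quat_def quat_eq_iff)
  have "inner (x * y) (x * y) = inner x x * inner y y"
    unfolding inner_quat_def quat_sel_times by algebra
  then show "norm (x * y) = norm x * norm y"
    by (simp only: norm_eq_sqrt_inner real_sqrt_mult)
qed

end

instantiation quat :: euclidean_space
begin

definition "Basis = {Quat 1 0 0 0, Quat 0 1 0 0, Quat 0 0 1 0, Quat 0 0 0 1}"

instance
proof
  fix x :: quat
  show "(\<forall>u\<in>Basis. inner x u = 0) \<longleftrightarrow> x = 0"
    by (simp add: Basis_quat_def inner_quat_def) (simp add: quat_eq_iff)
qed (auto simp: Basis_quat_def inner_quat_def)

end

lemma mult_qcnj: "x * qcnj x = of_real ((norm x)\<^sup>2)"
  by (simp add: quat_eq_iff of_real_def power2_norm_eq_inner inner_quat_def algebra_simps)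


section \<open>The sphere, its horizontal spaces and its metric\<close>

text \<open>
  The index type \<^typ>\<open>'n\<close> has \<open>n + 1\<close> elements, so \<^typ>\<open>quat^'n\<close> is \<open>H^(n+1)\<close> and
  \<^typ>\<open>quat^'n option\<close> is \<open>H^(n+2)\<close>, with \<^term>\<open>None\<close> as the index \<open>n + 2\<close>.
  The sphere \<open>S^(4n+3)\<close> is \<^term>\<open>sphere 0 1 :: (quat^'n) set\<close>, and the Euclidean metric on
  \<open>H^(n+1) = R^(4n+4)\<close> is \<^const>\<open>inner\<close>.
\<close>

definition sphere_tangent :: "quat^'n \<Rightarrow> (quat^'n) set"
  where "sphere_tangent \<zeta> = {v. inner v \<zeta> = 0}"

definition horizontal :: "quat^'n \<Rightarrow> (quat^'n) set"
  where "horizontal \<zeta> = {v. (\<Sum>l\<in>UNIV. v $ l * qcnj (\<zeta> $ l)) = 0}"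

lemma qre_sum: "qre (sum f A) = (\<Sum>x\<in>A. qre (f x))"
  by (induction A rule: infinite_finite_induct) simp_all

lemma horizontal_subset_tangent: "horizontal \<zeta> \<subseteq> sphere_tangent \<zeta>"
proof
  fix v assume "v \<in> horizontal \<zeta>"
  then have "qre (\<Sum>l\<in>UNIV. v $ l * qcnj (\<zeta> $ l)) = 0"
    by (simp add: horizontal_def)
  then show "v \<in> sphere_tangent \<zeta>"
    by (simp add: sphere_tangent_def qre_sum inner_vec_def inner_quat_def)
qed

text \<open>\<open>g\<^sub>S\<close> at \<open>\<zeta>\<close> is only defined on the horizontal space; elsewhere the value is
  \<^const>\<open>undefined\<close>.\<close>

definition qc_metric :: "quat^'n \<Rightarrow> (quat^'n) \<times> (quat^'n) \<Rightarrow> real"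
  where "qc_metric \<zeta> = (\<lambda>(u, v) \<in> horizontal \<zeta> \<times> horizontal \<zeta>. 4 * inner u v)"


section \<open>The differential of a map on the sphere\<close>

text \<open>
  The derivative within the sphere depends only on the restriction of \<open>F\<close> to the sphere. It is
  determined on tangent vectors (lemma \<open>pushforward_unique\<close>), though not on the normal direction,
  so only its values on \<^const>\<open>sphere_tangent\<close> are meaningful.
\<close>

definition pushforward :: "(quat^'n \<Rightarrow> quat^'n) \<Rightarrow> quat^'n \<Rightarrow> quat^'n \<Rightarrow> quat^'n"
  where "pushforward F \<zeta> = frechet_derivative F (at \<zeta> within sphere 0 1)"

lemma sphere_derivative_unique:
  fixes \<zeta> v :: "quat^'n"
  assumes D: "(F has_derivative D) (at \<zeta> within sphere 0 1)"
    and E: "(F has_derivative E) (at \<zeta> within sphere 0 1)"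
    and \<zeta>: "\<zeta> \<in> sphere 0 1" and v: "v \<in> sphere_tangent \<zeta>"
  shows "D v = E v"
proof (cases "v = 0")
  case True
  then show ?thesis
    using has_derivative_linear[OF D] has_derivative_linear[OF E] by (simp add: linear_0)
next
  case False
  define w where "w = v /\<^sub>R norm v"
  have "norm w = 1" "inner w \<zeta> = 0" "norm \<zeta> = 1"
    using False v \<zeta> by (simp_all add: w_def sphere_tangent_def)
  then have w: "inner w w = 1" "inner w \<zeta> = 0" "inner \<zeta> w = 0" "inner \<zeta> \<zeta> = 1"
    by (simp_all add: norm_eq_1 inner_commute)
  define c where "c = (\<lambda>t. cos t *\<^sub>R \<zeta> + sin t *\<^sub>R w)"
  have cS: "c t \<in> sphere 0 1" for t
  proof -
    have "inner (c t) (c t) = (cos t)\<^sup>2 + (sin t)\<^sup>2"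
      by (simp add: c_def inner_add_left inner_add_right w power2_eq_square)
    then show ?thesis by (simp add: norm_eq_1)
  qed
  have c: "(c has_derivative (\<lambda>t. t *\<^sub>R w)) (at 0)"
    unfolding c_def by (auto intro!: derivative_eq_intros)
  have c0: "c 0 = \<zeta>" by (simp add: c_def)
  have *: "((F \<circ> c) has_derivative (G \<circ> (\<lambda>t. t *\<^sub>R w))) (at 0)"
    if G: "(F has_derivative G) (at \<zeta> within sphere 0 1)" for G
  proof (rule diff_chain_within[OF c])
    show "(F has_derivative G) (at (c 0) within range c)"
      unfolding c0 by (rule has_derivative_subset[OF G]) (use cS in auto)
  qed
  have "D \<circ> (\<lambda>t. t *\<^sub>R w) = E \<circ> (\<lambda>t. t *\<^sub>R w)"
    by (rule has_derivative_unique[OF *[OF D] *[OF E]])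
  from fun_cong[OF this, of "norm v"] show ?thesis
    using False by (simp add: w_def)
qed

lemma pushforward_unique:
  assumes D: "(F has_derivative D) (at \<zeta> within sphere 0 1)"
    and "\<zeta> \<in> sphere 0 1" "v \<in> sphere_tangent \<zeta>"
  shows "pushforward F \<zeta> v = D v"
proof -
  have "(F has_derivative pushforward F \<zeta>) (at \<zeta> within sphere 0 1)"
    unfolding pushforward_def frechet_derivative_works[symmetric]
    using D unfolding differentiable_def by blast
  then show ?thesis
    by (rule sphere_derivative_unique[OF _ D assms(2,3)])
qed


section \<open>The group \<open>Sp(n+1,1)\<close> and its action\<close>

definition sp_form :: "quat^('n::finite option) \<Rightarrow> quat^('n option) \<Rightarrow> quat"
  where "sp_form q p = - (\<Sum>m\<in>UNIV. q $ Some m * qcnj (p $ Some m)) + q $ None * qcnj (p $ None)"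

text \<open>Row vectors are acted on from the right by \<^const>\<open>vector_matrix_mult\<close>, which multiplies the
  vector entries on the left of the matrix entries.\<close>

definition Sp :: "(quat^('n::finite option)^('n option)) set"
  where "Sp = {\<gamma>. \<forall>q p. sp_form (q v* \<gamma>) (p v* \<gamma>) = sp_form q p}"

definition lift1 :: "quat^'n::finite \<Rightarrow> quat^('n option)"
  where "lift1 q = (\<chi> k. case k of Some m \<Rightarrow> q $ m | None \<Rightarrow> 1)"

definition sp_act :: "quat^('n::finite option)^('n option) \<Rightarrow> quat^'n \<Rightarrow> quat^'n"
  where "sp_act \<gamma> q = (\<chi> l. inverse ((lift1 q v* \<gamma>) $ None) * (lift1 q v* \<gamma>) $ Some l)"

lemma sum_UNIV_option:
  "(\<Sum>k\<in>(UNIV :: 'n::finite option set). f k) = (\<Sum>m\<in>UNIV. f (Some m)) + (f None :: 'a::comm_monoid_add)"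
  by (simp add: UNIV_option_conv sum.reindex add.commute)

lemma lift1_mult:
  "(lift1 q v* \<gamma>) $ l = (\<Sum>m\<in>UNIV. q $ m * \<gamma> $ Some m $ l) + \<gamma> $ None $ l"
  by (simp add: vector_matrix_mult_def lift1_def sum_UNIV_option)

lemma sum_mult_qcnj: "(\<Sum>m\<in>UNIV. x $ m * qcnj (x $ m)) = of_real ((norm x)\<^sup>2)"
  by (simp add: mult_qcnj power2_norm_eq_inner inner_vec_def)

lemma sp_form_lift1:
  assumes "\<zeta> \<in> sphere 0 1"
  shows "sp_form (lift1 \<zeta>) (lift1 \<zeta>) = 0"
  using assms by (simp add: sp_form_def lift1_def sum_mult_qcnj quat_eq_iff)

lemma sp_form_self:
  "sp_form x x = of_real ((norm (x $ None))\<^sup>2 - (norm (\<chi> m. x $ Some m))\<^sup>2)"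
  using sum_mult_qcnj[of "\<chi> m. x $ Some m"] by (simp add: sp_form_def mult_qcnj)

lemma Sp_norm_eq:
  assumes "\<gamma> \<in> Sp" "\<zeta> \<in> sphere 0 1"
  shows "norm (\<chi> m. (lift1 \<zeta> v* \<gamma>) $ Some m) = norm ((lift1 \<zeta> v* \<gamma>) $ None)"
proof -
  have "sp_form (lift1 \<zeta> v* \<gamma>) (lift1 \<zeta> v* \<gamma>) = 0"
    using assms by (simp add: Sp_def sp_form_lift1)
  then have "(norm ((lift1 \<zeta> v* \<gamma>) $ None))\<^sup>2 = (norm (\<chi> m. (lift1 \<zeta> v* \<gamma>) $ Some m))\<^sup>2"
    unfolding sp_form_self of_real_eq_0_iff by simp
  then show ?thesis by simp
qed

lemma Sp_denominator_nonzero: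
  assumes "\<gamma> \<in> Sp" "\<zeta> \<in> sphere 0 1"
  shows "(lift1 \<zeta> v* \<gamma>) $ None \<noteq> 0"
proof
  assume 0: "(lift1 \<zeta> v* \<gamma>) $ None = 0"
  then have "(\<chi> m. (lift1 \<zeta> v* \<gamma>) $ Some m) = 0"
    using Sp_norm_eq[OF assms] by simp
  then have S: "(lift1 \<zeta> v* \<gamma>) $ Some m = 0" for m
    by (simp add: vec_eq_iff)
  define p :: "quat^('a option)" where "p = (\<chi> k. case k of Some m \<Rightarrow> 0 | None \<Rightarrow> 1)"
  have "sp_form (lift1 \<zeta>) p = sp_form (lift1 \<zeta> v* \<gamma>) (p v* \<gamma>)"
    using assms(1) by (simp add: Sp_def)
  also have "\<dots> = 0"
    by (simp add: sp_form_def 0 S)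
  finally show False
    by (simp add: sp_form_def p_def lift1_def quat_eq_iff qre_sum)
qed

lemma sp_act_in_sphere:
  assumes "\<gamma> \<in> Sp" "\<zeta> \<in> sphere 0 1"
  shows "sp_act \<gamma> \<zeta> \<in> sphere 0 1"
proof -
  let ?x = "lift1 \<zeta> v* \<gamma>"
  have "(norm (sp_act \<gamma> \<zeta>))\<^sup>2 = (norm (inverse (?x $ None)) * norm (\<chi> m. ?x $ Some m))\<^sup>2"
    by (simp add: sp_act_def norm_vec_def L2_set_def norm_mult power_mult_distrib
        sum_distrib_left sum_nonneg)
  also have "\<dots> = 1"
    using Sp_norm_eq[OF assms] Sp_denominator_nonzero[OF assms] by (simp add: norm_inverse)
  finally show ?thesis
    using norm_ge_zero[of "sp_act \<gamma> \<zeta>"] by (auto simp: power2_eq_1_iff simp del: norm_ge_zero)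
qed

lemma sp_act_differentiable:
  assumes "\<gamma> \<in> Sp" "\<zeta> \<in> sphere 0 1"
  shows "sp_act \<gamma> differentiable (at \<zeta> within sphere 0 1)"
proof -
  have comp: "((\<lambda>q. (lift1 q v* \<gamma>) $ l) has_derivative (\<lambda>v. \<Sum>m\<in>UNIV. v $ m * \<gamma> $ Some m $ l))
    (at \<zeta> within sphere 0 1)" for l
    unfolding lift1_mult
    by (auto intro!: derivative_eq_intros bounded_linear.has_derivative[OF bounded_linear_vec_nth])
  have "\<forall>l. \<exists>D. ((\<lambda>q. inverse ((lift1 q v* \<gamma>) $ None) * (lift1 q v* \<gamma>) $ Some l)
      has_derivative D) (at \<zeta> within sphere 0 1)"
  proof
    fix l
    show "\<exists>D. ((\<lambda>q. inverse ((lift1 q v* \<gamma>) $ None) * (lift1 q v* \<gamma>) $ Some l)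
      has_derivative D) (at \<zeta> within sphere 0 1)"
      by (rule exI) (rule has_derivative_mult Deriv.has_derivative_inverse comp
          Sp_denominator_nonzero[OF assms])+
  qed
  from choice[OF this] obtain D where
    D: "((\<lambda>q. inverse ((lift1 q v* \<gamma>) $ None) * (lift1 q v* \<gamma>) $ Some l)
      has_derivative D l) (at \<zeta> within sphere 0 1)" for l
    by blast
  have "(sp_act \<gamma> has_derivative (\<lambda>v. \<chi> l. D l v)) (at \<zeta> within sphere 0 1)"
    unfolding sp_act_def
  proof (rule has_derivative_componentwise_within[THEN iffD2], rule)
    fix b :: "quat^'a" assume "b \<in> Basis"
    then obtain l u where b: "b = axis l u" by (auto simp: Basis_vec_def)
    show "((\<lambda>q. inner (\<chi> l. inverse ((lift1 q v* \<gamma>) $ None) * (lift1 q v* \<gamma>) $ Some l) b)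
      has_derivative (\<lambda>v. inner (\<chi> l. D l v) b)) (at \<zeta> within sphere 0 1)"
      unfolding b inner_axis by (simp add: has_derivative_inner_left[OF D])
  qed
  then show ?thesis
    unfolding differentiable_def by blast
qed

end

theory Submission
  imports Defs
begin

text \<open>
  In homogeneous coordinates \<open>v\<close> is horizontal at \<open>\<zeta>\<close> iff \<open>(v, 0)\<close> is orthogonal, for the
  indefinite form, to the null vector \<open>(\<zeta>, 1)\<close>, and on vectors \<open>(v, 0)\<close> the form is minus the
  Euclidean one. Let \<open>X = (\<zeta>, 1) \<gamma>\<close> with last entry \<open>w\<close>. Then \<open>(\<gamma>(\<zeta>), 1) = w\<^sup>-\<^sup>1 X\<close>, and the
  differential satisfies \<open>(\<gamma>\<^sub>* v, 0) = w\<^sup>-\<^sup>1 ((v, 0) \<gamma> - t w\<^sup>-\<^sup>1 X)\<close> with \<open>t\<close> the last entry of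
  \<open>(v, 0) \<gamma>\<close>. Subtracting multiples of \<open>X\<close> does not change the form on the orthogonal complement
  of \<open>X\<close>, so the form is preserved up to conjugation by \<open>w\<^sup>-\<^sup>1\<close>.
\<close>

lemma qcnj_mult: "qcnj (x * y) = qcnj y * qcnj x"
  by (simp add: quat_eq_iff algebra_simps)

lemma qcnj_add: "qcnj (x + y) = qcnj x + qcnj y"
  by (simp add: quat_eq_iff)

lemma qcnj_diff: "qcnj (x - y) = qcnj x - qcnj y"
  by (simp add: quat_eq_iff)

lemma qcnj_qcnj: "qcnj (qcnj x) = x"
  by (simp add: quat_eq_iff)

lemma qcnj_0: "qcnj 0 = 0"
  by (simp add: quat_eq_iff)

lemma qcnj_eq_0_iff: "qcnj x = 0 \<longleftrightarrow> x = 0"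
  by (simp add: quat_eq_iff)

lemma qcnj_1: "qcnj 1 = 1"
  by (simp add: quat_eq_iff)

lemma qcnj_sum: "qcnj (sum f A) = (\<Sum>x\<in>A. qcnj (f x))"
  by (induction A rule: infinite_finite_induct) (simp_all add: qcnj_0 qcnj_add)

text \<open>The real part is invariant under cyclic permutation of factors, and
  \<open>qcnj c * c\<close> is the real number |c|^2. This produces the conformal factor.\<close>

lemma qre_conjugation: "qre (c * a * qcnj c) = (norm c)\<^sup>2 * qre a"
  by (simp add: power2_norm_eq_inner inner_quat_def algebra_simps)

lemma sp_form_diff_left: "sp_form (x - y) p = sp_form x p - sp_form y p"
  by (simp add: sp_form_def algebra_simps sum_subtractf)

lemma sp_form_scale_left: "sp_form (c *s x) p = c * sp_form x p"
  by (simp add: sp_form_def vector_scalar_mult_def algebra_simps sum_distrib_left)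

text \<open>Transfers the rules for the left slot to the right slot, and orthogonality to the
  opposite order.\<close>

lemma sp_form_hermitian: "qcnj (sp_form q p) = sp_form p q"
  by (simp add: sp_form_def qcnj_diff qcnj_sum qcnj_mult qcnj_qcnj)

lemma sp_form_diff_right: "sp_form p (x - y) = sp_form p x - sp_form p y"
  by (subst (1 2 3) sp_form_hermitian [symmetric])
    (simp add: sp_form_diff_left quat_eq_iff)

lemma sp_form_scale_right: "sp_form p (c *s x) = sp_form p x * qcnj c"
  by (subst (1 2) sp_form_hermitian [symmetric]) (simp add: sp_form_scale_left qcnj_mult)

text \<open>Pairing with \<open>axis k 1\<close> returns entry \<open>k\<close> of \<open>x\<close>
  up to sign.\<close>

lemma sp_form_nondegenerate:
  assumes "\<And>p. sp_form x p = 0"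
  shows "x = 0"
proof -
  have "x $ k = 0" for k
    using assms[of "axis k 1"]
    by (cases k) (simp_all add: sp_form_def axis_def if_distrib[of qcnj] qcnj_0 qcnj_1
        if_distrib[of "(*) _"] cong: if_cong)
  then show ?thesis by (simp add: vec_eq_iff)
qed

lemma vector_matrix_diff_left: "(x - y) v* A = x v* A - y v* (A :: 'a::ring_1^'n^'m::finite)"
  by (simp add: vector_matrix_mult_def vec_eq_iff left_diff_distrib sum_subtractf)

lemma vector_matrix_scale_left: "(c *s x) v* A = c *s (x v* (A :: 'a::semiring_1^'n^'m::finite))"
  by (simp add: vector_matrix_mult_def vec_eq_iff vector_scalar_mult_def mult.assoc
      sum_distrib_left)

text \<open>\<open>Sp\<close> is defined by preservation of the form alone. Nondegeneracy makes the
  action injective, and an injective real-linear endomorphism of a finite-dimensional space is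
  onto.\<close>

lemma Sp_surj:
  assumes "\<gamma> \<in> Sp"
  shows "surj (\<lambda>q. q v* \<gamma>)"
proof -
  have lin: "linear (\<lambda>q. q v* \<gamma>)"
    by (intro linearI)
      (simp_all add: vector_matrix_mult_def vec_eq_iff distrib_right sum.distrib scaleR_sum_right)
  have "q = 0" if "q v* \<gamma> = 0" for q
  proof (rule sp_form_nondegenerate)
    fix p
    have "sp_form q p = sp_form (q v* \<gamma>) (p v* \<gamma>)"
      using assms by (simp add: Sp_def)
    then show "sp_form q p = 0"
      by (simp add: that sp_form_def)
  qed
  then have "inj (\<lambda>q. q v* \<gamma>)"
    using linear_injective_0[OF lin] by blast
  then show ?thesis
    by (rule linear_injective_imp_surjective[OF lin _ refl])
qed

text \<open>The differential of the affine map \<open>lift1\<close>, whose constant last entry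
  contributes 0.\<close>

definition lift0 :: "quat^'n::finite \<Rightarrow> quat^('n option)"
  where "lift0 v = (\<chi> k. case k of Some m \<Rightarrow> v $ m | None \<Rightarrow> 0)"

lemma lift0_nth [simp]: "lift0 v $ Some m = v $ m" "lift0 v $ None = 0"
  by (simp_all add: lift0_def)

lemma lift1_nth [simp]: "lift1 v $ Some m = v $ m" "lift1 v $ None = 1"
  by (simp_all add: lift1_def)

lemma horizontal_iff_sp_form: "v \<in> horizontal \<zeta> \<longleftrightarrow> sp_form (lift0 v) (lift1 \<zeta>) = 0"
  by (simp add: horizontal_def sp_form_def)

lemma inner_eq_sp_form: "inner u v = - qre (sp_form (lift0 u) (lift0 v))"
  by (simp add: sp_form_def qre_sum inner_vec_def inner_quat_def)

lemma lift0_mult: "(lift0 v v* \<gamma>) $ l = (\<Sum>m\<in>UNIV. v $ m * \<gamma> $ Some m $ l)"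
  by (simp add: vector_matrix_mult_def sum_UNIV_option)

lemma lift1_sp_act:
  assumes "(lift1 \<zeta> v* \<gamma>) $ None \<noteq> 0"
  shows "lift1 (sp_act \<gamma> \<zeta>) = inverse ((lift1 \<zeta> v* \<gamma>) $ None) *s (lift1 \<zeta> v* \<gamma>)"
proof -
  have "lift1 (sp_act \<gamma> \<zeta>) $ k = (inverse ((lift1 \<zeta> v* \<gamma>) $ None) *s (lift1 \<zeta> v* \<gamma>)) $ k" for k
    using assms by (cases k) (simp_all add: sp_act_def)
  then show ?thesis by (simp add: vec_eq_iff)
qed

text \<open>The quotient rule for a left quotient x^-1 y of quaternions, where d(x^-1) = - x^-1 dx
  x^-1. Here \<open>w\<close> is already the inverse of the denominator.\<close>

definition sp_act_deriv :: "quat^('n::finite option)^('n option) \<Rightarrow> quat^'n \<Rightarrow> quat^'n \<Rightarrow> quat^'n"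
  where "sp_act_deriv \<gamma> \<zeta> v = (\<chi> l. let w = inverse ((lift1 \<zeta> v* \<gamma>) $ None) in
    w * ((lift0 v v* \<gamma>) $ Some l - (lift0 v v* \<gamma>) $ None * w * (lift1 \<zeta> v* \<gamma>) $ Some l))"

lemma sp_act_has_derivative:
  assumes "(lift1 \<zeta> v* \<gamma>) $ None \<noteq> 0"
  shows "(sp_act \<gamma> has_derivative sp_act_deriv \<gamma> \<zeta>) (at \<zeta> within S)"
proof -
  have comp: "((\<lambda>q. (lift1 q v* \<gamma>) $ l) has_derivative (\<lambda>v. (lift0 v v* \<gamma>) $ l))
    (at \<zeta> within S)" for l
    unfolding lift1_mult lift0_mult
    by (auto intro!: derivative_eq_intros bounded_linear.has_derivative[OF bounded_linear_vec_nth])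
  have D: "((\<lambda>q. inverse ((lift1 q v* \<gamma>) $ None) * (lift1 q v* \<gamma>) $ Some l)
      has_derivative (\<lambda>v. sp_act_deriv \<gamma> \<zeta> v $ l)) (at \<zeta> within S)" for l
    by (rule has_derivative_eq_rhs, (rule has_derivative_mult Deriv.has_derivative_inverse comp assms)+)
      (simp add: sp_act_deriv_def fun_eq_iff Let_def algebra_simps)
  show ?thesis
  proof (rule has_derivative_componentwise_within[THEN iffD2], rule)
    fix b :: "quat^'a" assume "b \<in> Basis"
    then obtain l u where b: "b = axis l u" by (auto simp: Basis_vec_def)
    show "((\<lambda>q. inner (sp_act \<gamma> q) b) has_derivative (\<lambda>v. inner (sp_act_deriv \<gamma> \<zeta> v) b))
      (at \<zeta> within S)"
      unfolding b inner_axis by (simp add: sp_act_def has_derivative_inner_left[OF D])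
  qed
qed

text \<open>The multiple of \<open>lift1 \<zeta> v* \<gamma>\<close> is the one that cancels the
  last entry; in the other entries this is the quotient rule.\<close>

lemma lift0_sp_act_deriv:
  fixes \<gamma> :: "quat^('n::finite option)^('n option)" and \<zeta> :: "quat^'n"
  defines "w \<equiv> (lift1 \<zeta> v* \<gamma>) $ None"
  assumes "w \<noteq> 0"
  shows "lift0 (sp_act_deriv \<gamma> \<zeta> v) = inverse w *s
    (lift0 v v* \<gamma> - ((lift0 v v* \<gamma>) $ None * inverse w) *s (lift1 \<zeta> v* \<gamma>))" (is "?L = ?R")
proof -
  have "?L $ k = ?R $ k" for k
    using assms by (cases k) (simp_all add: sp_act_deriv_def Let_def algebra_simps)
  then show ?thesis by (simp add: vec_eq_iff)
qed

context
  fixes \<gamma> :: "quat^('n::finite option)^('n option)" and \<zeta> :: "quat^'n"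
  assumes \<gamma>: "\<gamma> \<in> Sp" and \<zeta>: "\<zeta> \<in> sphere 0 1"
begin

lemma Sp_form_eq: "sp_form (q v* \<gamma>) (p v* \<gamma>) = sp_form q p"
  using \<gamma> by (simp add: Sp_def)

text \<open>Both terms of the lifted differential are orthogonal to
  \<open>lift1 \<zeta> v* \<gamma>\<close>: the first by horizontality of \<open>v\<close>, the
  second because that vector is null.\<close>

lemma sp_act_deriv_horizontal:
  assumes "v \<in> horizontal \<zeta>"
  shows "sp_act_deriv \<gamma> \<zeta> v \<in> horizontal (sp_act \<gamma> \<zeta>)"
  using assms Sp_denominator_nonzero[OF \<gamma> \<zeta>]
  by (simp add: horizontal_iff_sp_form lift0_sp_act_deriv lift1_sp_act sp_form_scale_left
      sp_form_scale_right sp_form_diff_left Sp_form_eq sp_form_lift1[OF \<zeta>])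

lemma inner_sp_act_deriv:
  assumes u: "u \<in> horizontal \<zeta>" and v: "v \<in> horizontal \<zeta>"
  shows "inner (sp_act_deriv \<gamma> \<zeta> u) (sp_act_deriv \<gamma> \<zeta> v) =
    inner u v / (norm ((lift1 \<zeta> v* \<gamma>) $ None))\<^sup>2"
proof -
  have u': "sp_form (lift0 u) (lift1 \<zeta>) = 0"
    using u by (simp add: horizontal_iff_sp_form)
  have v': "sp_form (lift1 \<zeta>) (lift0 v) = 0"
    using v by (subst sp_form_hermitian[symmetric]) (simp add: horizontal_iff_sp_form qcnj_0)
  define c where "c = inverse ((lift1 \<zeta> v* \<gamma>) $ None)"
  \<comment> \<open>The cross terms vanish by \<open>u'\<close> and \<open>v'\<close>, the remaining
    correction term by nullity of \<open>lift1 \<zeta>\<close>.\<close>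
  have "sp_form (lift0 (sp_act_deriv \<gamma> \<zeta> u)) (lift0 (sp_act_deriv \<gamma> \<zeta> v)) =
      c * sp_form (lift0 u) (lift0 v) * qcnj c"
    using Sp_denominator_nonzero[OF \<gamma> \<zeta>]
    by (simp add: lift0_sp_act_deriv sp_form_scale_left c_def
      sp_form_scale_right sp_form_diff_left sp_form_diff_right Sp_form_eq sp_form_lift1[OF \<zeta>]
      u' v' mult.assoc)
  then show ?thesis
    by (simp add: inner_eq_sp_form qre_conjugation c_def norm_inverse power_inverse
        divide_inverse del: quat_sel_times)
qed

lemma horizontal_sp_act: "horizontal (sp_act \<gamma> \<zeta>) = sp_act_deriv \<gamma> \<zeta> ` horizontal \<zeta>"
proof
  show "sp_act_deriv \<gamma> \<zeta> ` horizontal \<zeta> \<subseteq> horizontal (sp_act \<gamma> \<zeta>)"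
    using sp_act_deriv_horizontal by blast
next
  note nz = Sp_denominator_nonzero[OF \<gamma> \<zeta>]
  show "horizontal (sp_act \<gamma> \<zeta>) \<subseteq> sp_act_deriv \<gamma> \<zeta> ` horizontal \<zeta>"
  proof
    fix e assume e: "e \<in> horizontal (sp_act \<gamma> \<zeta>)"
    define w where "w = (lift1 \<zeta> v* \<gamma>) $ None"
    \<comment> \<open>The factor \<open>w\<close> compensates the outer inverse in the
      differential.\<close>
    obtain z where z: "z v* \<gamma> = w *s lift0 e"
      using surjD[OF Sp_surj[OF \<gamma>], of "w *s lift0 e"] by metis
    \<comment> \<open>Subtracting this multiple of \<open>lift1 \<zeta>\<close> makes the last entry
      of \<open>z\<close> zero. It changes the image under \<gamma> only by a multiple of
      \<open>lift1 \<zeta> v* \<gamma>\<close>, which the differential discards.\<close>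
    define u where "u = (\<chi> m. z $ Some m - z $ None * \<zeta> $ m)"
    have "lift0 u $ k = (z - z $ None *s lift1 \<zeta>) $ k" for k
      by (cases k) (simp_all add: u_def)
    then have u: "lift0 u = z - z $ None *s lift1 \<zeta>"
      by (simp add: vec_eq_iff)
    then have u\<gamma>: "lift0 u v* \<gamma> = w *s lift0 e - z $ None *s (lift1 \<zeta> v* \<gamma>)"
      by (simp add: vector_matrix_diff_left vector_matrix_scale_left z)
    have "sp_form (lift0 e) (lift1 \<zeta> v* \<gamma>) = 0"
      using e nz by (simp add: horizontal_iff_sp_form lift1_sp_act sp_form_scale_right qcnj_eq_0_iff)
    then have "sp_form (lift0 u) (lift1 \<zeta>) = 0"
      unfolding Sp_form_eq[symmetric, of "lift0 u"] u\<gamma>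
      by (simp add: sp_form_diff_left sp_form_scale_left Sp_form_eq sp_form_lift1[OF \<zeta>])
    then have "u \<in> horizontal \<zeta>"
      by (simp add: horizontal_iff_sp_form)
    \<comment> \<open>The last entry of \<open>lift0 u v* \<gamma>\<close> is
      \<open>- (z $ None * w)\<close>, so the correction term restores
      \<open>w *s lift0 e\<close>.\<close>
    moreover have "sp_act_deriv \<gamma> \<zeta> u = e"
      using nz by (simp add: sp_act_deriv_def u\<gamma> w_def Let_def vec_eq_iff mult.assoc[symmetric]
          mult.assoc[of "z $ None" "(lift1 \<zeta> v* \<gamma>) $ None" "inverse ((lift1 \<zeta> v* \<gamma>) $ None)"])
    ultimately show "e \<in> sp_act_deriv \<gamma> \<zeta> ` horizontal \<zeta>"
      by blast
  qed
qed

end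

theorem proposition2p3:
  fixes \<gamma> :: "quat^('n::finite option)^('n option)" and \<zeta> :: "quat^'n"
  assumes "\<gamma> \<in> Sp" and "\<zeta> \<in> sphere 0 1"
  shows "horizontal (sp_act \<gamma> \<zeta>) = pushforward (sp_act \<gamma>) \<zeta> ` horizontal \<zeta> \<and>
    (\<forall>u \<in> horizontal \<zeta>. \<forall>v \<in> horizontal \<zeta>.
      qc_metric (sp_act \<gamma> \<zeta>) (pushforward (sp_act \<gamma>) \<zeta> u, pushforward (sp_act \<gamma>) \<zeta> v) =
      1 / (norm ((lift1 \<zeta> v* \<gamma>) $ None))\<^sup>2 * qc_metric \<zeta> (u, v))"
proof -
  \<comment> \<open>Horizontal vectors are tangent, and on tangent vectors the derivative within the
    sphere is unique.\<close>
  have P: "pushforward (sp_act \<gamma>) \<zeta> v = sp_act_deriv \<gamma> \<zeta> v" if "v \<in> horizontal \<zeta>" for v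
    using that horizontal_subset_tangent sp_act_has_derivative[OF Sp_denominator_nonzero[OF assms]]
    by (intro pushforward_unique[OF _ assms(2)]) auto
  then have "pushforward (sp_act \<gamma>) \<zeta> ` horizontal \<zeta> = sp_act_deriv \<gamma> \<zeta> ` horizontal \<zeta>"
    by (rule image_cong[OF refl])
  \<comment> \<open>The equality of horizontal spaces also places the pushed vectors where
    \<open>qc_metric\<close> is not \<open>undefined\<close>.\<close>
  then show ?thesis
    by (simp add: horizontal_sp_act[OF assms] P qc_metric_def inner_sp_act_deriv[OF assms])
qed

end
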